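(* Consider the $n$-bus DC microgrid system $\dot x = Ax+Bv^{\mathrm{ref}}+Ch(p,x)$ with uncertain constant power loads $p\in\mathcal{P}$ and load-voltage constraint set $\mathcal{V}_l^e$. Let $\overline{A}_z=A+\sum_{k=1}^n\overline{\delta}_kD_{3n+k}$ and $\overline{\delta}_{\max}=\max_{1\le k\le n}\overline{\delta}_k$. The system is locally robustly stable (every equilibrium in $\mathcal{X}_e(\mathcal{P},\mathcal{V}_l^e)$ is locally exponentially stable) if there exist $P=P^T\succ0$ in $\mathbb{R}^{4n\times4n}$, $\gamma>0$ and $t>0$ such that the following optimization problem is feasible (i.e. its constraints are satisfied): $$\min_{P,t,\gamma}\ t-\gamma$$ subject to $$P\overline{A}_z+\overline{A}_z^TP\preceq-\gamma I_{4n},\qquad P\preceq tI_{4n},\qquad 2t\,\overline{\delta}_{\max}<\gamma,\qquad P=P^T,\ P\succ0,\ \gamma>0,\ t>0.$$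
   Context: Microgrid model. Let $n\ge 1$ and let $\mathcal{G}=(\mathcal{V},\mathcal{E})$ be an undirected graph on $\{1,\dots,n\}$ without self-loops; $\mathcal{N}_k$ is the set of neighbours of $k$. For each $k$ let $L_{sk},r_{sk},L_{lk},r_{lk},C_{lk},C_{bk}>0$ be constants, let $r_{kj}=r_{jk}>0$ for $(k,j)\in\mathcal{E}$, and let $d_k$ (droop gain) and $v_k^{\mathrm{ref}}$ be real constants. The dynamics of bus $k$ are $$L_{sk}\frac{di_{sk}}{dt}=v_k^{\mathrm{ref}}-(r_{sk}+d_k)i_{sk}-v_{bk},\qquad L_{lk}\frac{di_{lk}}{dt}=v_{bk}-r_{lk}i_{lk}-v_{lk},$$ $$C_{bk}\frac{dv_{bk}}{dt}=i_{sk}-i_{lk}-\sum_{j\in\mathcal{N}_k}\frac{v_{bk}-v_{bj}}{r_{kj}},\qquad C_{lk}\frac{dv_{lk}}{dt}=i_{lk}-\frac{p_k}{v_{lk}},$$ where $p_k$ is the (constant in time) power of the $k$-th load. The state is $x=[i_{s1},\dots,i_{sn},i_{l1},\dots,i_{ln},v_{b1},\dots,v_{bn},v_{l1},\dots,v_{ln}]^T\in\mathbb{R}^{4n}$. With $p=[p_1,\dots,p_n]^T$, $v^{\mathrm{ref}}=[v_1^{\mathrm{ref}},\dots,v_n^{\mathrm{ref}}]^T$ and $h(p,x)=[-p_1/v_{l1},\dots,-p_n/v_{ln}]^T$, these equations are written as $\dot x=Ax+Bv^{\mathrm{ref}}+Ch(p,x)$, with constant matrices $A\in\mathbb{R}^{4n\times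 4n}$, $B,C\in\mathbb{R}^{4n\times n}$ read off from the equations above (so the only nonzero entries of $C$ are $C_{3n+k,k}=1/C_{lk}$). Uncertainty. $\mathcal{P}=\{p\in\mathbb{R}^n: p_k\in[\underline{p_k},\overline{p_k}],\ k=1,\dots,n\}$ with $\overline{p_k}\ge\underline{p_k}\ge 0$, and $\mathcal{V}_l^e=\{v_l^e\in\mathbb{R}^n: v_{lk}^e\in[\underline{v_{lk}^e},\overline{v_{lk}^e}],\ k=1,\dots,n\}$ with $\overline{v_{lk}^e}\ge\underline{v_{lk}^e}>0$. For an equilibrium $x_e\in\mathbb{R}^{4n}$, $v_l^e=[v_{l1}^e,\dots,v_{ln}^e]^T$ denotes its load-voltage components (its last $n$ entries). Define $$\mathcal{X}_e(\mathcal{P},\mathcal{V}_l^e)=\{x_e\in\mathbb{R}^{4n}: Ax_e+Bv^{\mathrm{ref}}+Ch(p,x_e)=0 \text{ for some } p\in\mathcal{P},\ v_l^e\in\mathcal{V}_l^e\}.$$ The system is called locally robustly stable if every $x_e\in\mathcal{X}_e(\mathcal{P},\mathcal{V}_l^e)$ is a locally exponentially stable equilibrium (of the system with the corresponding $p$). Notation. $D_m\in\mathbb{R}^{4n\times 4n}$ is the matrix whose only nonzero entry is its $m$-th diagonal entry, equal to $1$. $\overline{\delta}_k=\overline{p_k}/(C_{lk}(\underline{v_{lk}^e})^2)$. $I_{4n}$ is the identity; $M\succ0$ means positive definite, and $M\preceq N$ means $N-M$ is positive semidefinite. *)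

theory Defs
  imports "HOL-Analysis.Analysis"
begin

section \<open>Local exponential stability of an autonomous system\<close>

definition solution_on :: "('a::real_normed_vector \<Rightarrow> 'a) \<Rightarrow> 'a set \<Rightarrow> (real \<Rightarrow> 'a) \<Rightarrow> real set \<Rightarrow> bool" where
  "solution_on f D x J \<longleftrightarrow>
     (\<forall>t\<in>J. x t \<in> D \<and> (x has_vector_derivative f (x t)) (at t within J))"

text \<open>
  \<open>D\<close> is the domain of the vector field. For every initial state near \<open>xe\<close> a solution exists for
  all forward time (so the decay estimate is not vacuous), and every solution starting there, also
  one given only on a bounded time interval, obeys the decay estimate. As the system is
  autonomous, the initial time is taken to be \<open>0\<close>.
\<close>

definition locally_exponentially_stable ::
    "('a::real_normed_vector \<Rightarrow> 'a) \<Rightarrow> 'a set \<Rightarrow> 'a \<Rightarrow> bool" where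
  "locally_exponentially_stable f D xe \<longleftrightarrow>
     xe \<in> D \<and> f xe = 0 \<and>
     (\<exists>c>0. \<exists>K>0. \<exists>\<mu>>0. \<forall>x0. norm (x0 - xe) < c \<longrightarrow>
        (\<exists>x. x 0 = x0 \<and> solution_on f D x {0..}) \<and>
        (\<forall>x T. 0 \<le> T \<longrightarrow> x 0 = x0 \<longrightarrow> solution_on f D x {0..T} \<longrightarrow>
           norm (x T - xe) \<le> K * exp (- \<mu> * T) * norm (x0 - xe)))"


section \<open>Definite matrices\<close>

definition pos_def :: "real^'m^'m \<Rightarrow> bool" where
  "pos_def M \<longleftrightarrow> transpose M = M \<and> (\<forall>x. x \<noteq> 0 \<longrightarrow> 0 < x \<bullet> (M *v x))"

definition pos_semidef :: "real^'m^'m \<Rightarrow> bool" where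
  "pos_semidef M \<longleftrightarrow> transpose M = M \<and> (\<forall>x. 0 \<le> x \<bullet> (M *v x))"

definition loewner_le :: "real^'m^'m \<Rightarrow> real^'m^'m \<Rightarrow> bool" (infix "\<preceq>" 50) where
  "M \<preceq> N \<longleftrightarrow> pos_semidef (N - M)"

text \<open>The matrix whose only nonzero entry is a \<open>1\<close> at diagonal position \<open>m\<close>.\<close>

definition diag_unit :: "'m \<Rightarrow> real^'m^'m" where
  "diag_unit m = (\<chi> i j. if i = m \<and> j = m then 1 else 0)"


section \<open>The microgrid\<close>

text \<open>
  The buses are the elements of the finite type \<open>'n\<close>. The state of dimension \<open>4 * CARD('n)\<close> is
  indexed by the following type; \<open>IS k\<close>, \<open>IL k\<close>, \<open>VB k\<close>, \<open>VL k\<close> play the roles of the numerical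
  indices \<open>k\<close>, \<open>n + k\<close>, \<open>2 * n + k\<close>, \<open>3 * n + k\<close>.
\<close>

datatype 'n state_index = IS 'n | IL 'n | VB 'n | VL 'n

lemma UNIV_state_index:
  "(UNIV :: 'n state_index set) = range IS \<union> range IL \<union> range VB \<union> range VL"
proof -
  have "i \<in> range IS \<union> range IL \<union> range VB \<union> range VL" for i :: "'n state_index"
    by (cases i) auto
  then show ?thesis by auto
qed

instance state_index :: (finite) finite
  by standard (simp add: UNIV_state_index)

lemma sum_state_index:
  fixes g :: "'n::finite state_index \<Rightarrow> 'b::comm_monoid_add"
  shows "(\<Sum>i\<in>UNIV. g i) =
    (\<Sum>k\<in>UNIV. g (IS k)) + (\<Sum>k\<in>UNIV. g (IL k)) + (\<Sum>k\<in>UNIV. g (VB k)) + (\<Sum>k\<in>UNIV. g (VL k))"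
proof -
  have "(\<Sum>i\<in>UNIV. g i) = sum g (range IS) + sum g (range IL) + sum g (range VB) + sum g (range VL)"
    unfolding UNIV_state_index by (subst sum.union_disjoint; auto)+
  then show ?thesis
    by (simp add: sum.reindex inj_def)
qed

lemma CARD_state_index: "CARD('n::finite state_index) = 4 * CARD('n)"
  using sum_state_index[where g = "\<lambda>_::'n state_index. 1::nat"] by simp

record 'n microgrid =
  edges :: "('n \<times> 'n) set"
  L_s :: "'n \<Rightarrow> real"
  r_s :: "'n \<Rightarrow> real"
  L_l :: "'n \<Rightarrow> real"
  r_l :: "'n \<Rightarrow> real"
  C_l :: "'n \<Rightarrow> real"
  C_b :: "'n \<Rightarrow> real"
  r_line :: "'n \<Rightarrow> 'n \<Rightarrow> real"
  droop :: "'n \<Rightarrow> real"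
  v_ref :: "'n \<Rightarrow> real"

definition nbrs :: "'n microgrid \<Rightarrow> 'n \<Rightarrow> 'n set" where
  "nbrs G k = {j. (k, j) \<in> edges G}"

definition valid_microgrid :: "'n microgrid \<Rightarrow> bool" where
  "valid_microgrid G \<longleftrightarrow>
     sym (edges G) \<and> irrefl (edges G) \<and>
     (\<forall>k. 0 < L_s G k \<and> 0 < r_s G k \<and> 0 < L_l G k \<and> 0 < r_l G k \<and> 0 < C_l G k \<and> 0 < C_b G k) \<and>
     (\<forall>(k, j) \<in> edges G. 0 < r_line G k j \<and> r_line G k j = r_line G j k)"

definition matA :: "'n::finite microgrid \<Rightarrow> real^'n state_index^'n state_index" where
  "matA G = (\<chi> a b. case a of
      IS k \<Rightarrow> (case b of
          IS j \<Rightarrow> if j = k then - (r_s G k + droop G k) / L_s G k else 0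
        | IL j \<Rightarrow> 0
        | VB j \<Rightarrow> if j = k then - 1 / L_s G k else 0
        | VL j \<Rightarrow> 0)
    | IL k \<Rightarrow> (case b of
          IS j \<Rightarrow> 0
        | IL j \<Rightarrow> if j = k then - r_l G k / L_l G k else 0
        | VB j \<Rightarrow> if j = k then 1 / L_l G k else 0
        | VL j \<Rightarrow> if j = k then - 1 / L_l G k else 0)
    | VB k \<Rightarrow> (case b of
          IS j \<Rightarrow> if j = k then 1 / C_b G k else 0
        | IL j \<Rightarrow> if j = k then - 1 / C_b G k else 0
        | VB j \<Rightarrow> if j = k then - (\<Sum>i\<in>nbrs G k. 1 / r_line G k i) / C_b G k
                  else if j \<in> nbrs G k then 1 / (r_line G k j * C_b G k) else 0
        | VL j \<Rightarrow> 0)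
    | VL k \<Rightarrow> (case b of
          IS j \<Rightarrow> 0
        | IL j \<Rightarrow> if j = k then 1 / C_l G k else 0
        | VB j \<Rightarrow> 0
        | VL j \<Rightarrow> 0))"

definition matB :: "'n::finite microgrid \<Rightarrow> real^'n^'n state_index" where
  "matB G = (\<chi> a j. case a of IS k \<Rightarrow> if j = k then 1 / L_s G k else 0 | _ \<Rightarrow> 0)"

definition matC :: "'n::finite microgrid \<Rightarrow> real^'n^'n state_index" where
  "matC G = (\<chi> a j. case a of VL k \<Rightarrow> if j = k then 1 / C_l G k else 0 | _ \<Rightarrow> 0)"

definition load_currents :: "real^'n \<Rightarrow> real^'n state_index \<Rightarrow> real^'n" where
  "load_currents p x = (\<chi> k. - (p $ k) / x $ VL k)"

definition microgrid_field ::
    "'n::finite microgrid \<Rightarrow> real^'n \<Rightarrow> real^'n state_index \<Rightarrow> real^'n state_index" where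
  "microgrid_field G p x =
     matA G *v x + matB G *v (\<chi> k. v_ref G k) + matC G *v load_currents p x"

text \<open>The states at which the terms \<open>p $ k / x $ VL k\<close> are meaningful.\<close>

definition microgrid_domain :: "(real^('n::finite) state_index) set" where
  "microgrid_domain = {x. \<forall>k. x $ VL k \<noteq> 0}"

text \<open>The matrix form agrees with the circuit equations of the individual buses.\<close>

lemma microgrid_field_components:
  fixes G :: "'n::finite microgrid"
  assumes "valid_microgrid G"
  shows "L_s G k * microgrid_field G p x $ IS k =
           v_ref G k - (r_s G k + droop G k) * x $ IS k - x $ VB k"
    and "L_l G k * microgrid_field G p x $ IL k = x $ VB k - r_l G k * x $ IL k - x $ VL k"
    and "C_b G k * microgrid_field G p x $ VB k =
           x $ IS k - x $ IL k - (\<Sum>j\<in>nbrs G k. (x $ VB k - x $ VB j) / r_line G k j)"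
    and "C_l G k * microgrid_field G p x $ VL k = x $ IL k - p $ k / x $ VL k"
proof -
  have pos: "L_s G k \<noteq> 0" "L_l G k \<noteq> 0" "C_b G k \<noteq> 0" "C_l G k \<noteq> 0"
    using assms unfolding valid_microgrid_def by (auto simp: less_imp_neq[symmetric])
  have k: "k \<notin> nbrs G k"
    using assms by (auto simp: valid_microgrid_def nbrs_def irrefl_def)
  have row_delta: "(\<Sum>j\<in>UNIV. (if j = k then c else 0) * y j) = c * y k" for c :: real and y
    by (simp add: if_distrib[of "\<lambda>c. c * _"] sum.delta cong: if_cong)
  note unf = microgrid_field_def matA_def matB_def matC_def
    matrix_vector_mult_def sum_state_index row_delta
  show "L_s G k * microgrid_field G p x $ IS k =
      v_ref G k - (r_s G k + droop G k) * x $ IS k - x $ VB k"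
    using pos by (simp add: unf) (simp add: field_simps)
  show "L_l G k * microgrid_field G p x $ IL k = x $ VB k - r_l G k * x $ IL k - x $ VL k"
    using pos by (simp add: unf) (simp add: field_simps)
  show "C_l G k * microgrid_field G p x $ VL k = x $ IL k - p $ k / x $ VL k"
    using pos by (simp add: unf) (simp add: load_currents_def field_simps)
  let ?S = "\<Sum>i\<in>nbrs G k. 1 / r_line G k i"
  have row: "(\<Sum>j\<in>UNIV. (if j = k then - ?S / C_b G k
        else if j \<in> nbrs G k then 1 / (r_line G k j * C_b G k) else 0) * x $ VB j) =
      - ?S / C_b G k * x $ VB k + (\<Sum>j\<in>nbrs G k. x $ VB j / r_line G k j) / C_b G k"
    (is "?l = _")
  proof -
    have "?l = (\<Sum>j\<in>UNIV. (if j = k then - ?S / C_b G k * x $ VB k else 0) +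
        (if j \<in> nbrs G k then x $ VB j / r_line G k j / C_b G k else 0))"
      using k by (intro sum.cong) auto
    also have "\<dots> = - ?S / C_b G k * x $ VB k +
        (\<Sum>j\<in>UNIV. if j \<in> nbrs G k then x $ VB j / r_line G k j / C_b G k else 0)"
      by (subst sum.distrib) (simp add: sum.delta)
    also have "(\<Sum>j\<in>UNIV. if j \<in> nbrs G k then x $ VB j / r_line G k j / C_b G k else 0) =
        (\<Sum>j\<in>nbrs G k. x $ VB j / r_line G k j / C_b G k)"
      by (subst sum.inter_restrict[symmetric]) auto
    finally show ?thesis by (simp add: sum_divide_distrib)
  qed
  have "microgrid_field G p x $ VB k = x $ IS k / C_b G k - x $ IL k / C_b G k
      + (- ?S / C_b G k * x $ VB k + (\<Sum>j\<in>nbrs G k. x $ VB j / r_line G k j) / C_b G k)"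
    unfolding row[symmetric]
    by (simp add: unf)
  then have "C_b G k * microgrid_field G p x $ VB k =
      x $ IS k - x $ IL k - (?S * x $ VB k - (\<Sum>j\<in>nbrs G k. x $ VB j / r_line G k j))"
    using pos by (simp add: distrib_left right_diff_distrib)
  moreover have "(\<Sum>j\<in>nbrs G k. (x $ VB k - x $ VB j) / r_line G k j) =
      ?S * x $ VB k - (\<Sum>j\<in>nbrs G k. x $ VB j / r_line G k j)"
    by (simp add: diff_divide_distrib sum_subtractf sum_distrib_right)
  ultimately show "C_b G k * microgrid_field G p x $ VB k =
      x $ IS k - x $ IL k - (\<Sum>j\<in>nbrs G k. (x $ VB k - x $ VB j) / r_line G k j)"
    by simp
qed


section \<open>Uncertainty and robust stability\<close>

definition load_voltages :: "real^'n state_index \<Rightarrow> real^'n" where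
  "load_voltages x = (\<chi> k. x $ VL k)"

definition equilibria ::
    "'n::finite microgrid \<Rightarrow> (real^'n) set \<Rightarrow> (real^'n) set \<Rightarrow> (real^'n state_index) set" where
  "equilibria G \<P> \<V> =
     {xe. (\<exists>p\<in>\<P>. microgrid_field G p xe = 0) \<and> load_voltages xe \<in> \<V>}"

definition locally_robustly_stable ::
    "'n::finite microgrid \<Rightarrow> (real^'n) set \<Rightarrow> (real^'n) set \<Rightarrow> bool" where
  "locally_robustly_stable G \<P> \<V> \<longleftrightarrow>
     (\<forall>xe \<in> equilibria G \<P> \<V>. \<forall>p\<in>\<P>. microgrid_field G p xe = 0 \<longrightarrow>
        locally_exponentially_stable (microgrid_field G p) microgrid_domain xe)"

text \<open>Here \<open>p_hi\<close> holds the upper load powers and \<open>v_lo\<close> the lower load voltages.\<close>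

definition delta_bar :: "'n microgrid \<Rightarrow> real^'n \<Rightarrow> real^'n \<Rightarrow> 'n \<Rightarrow> real" where
  "delta_bar G p_hi v_lo k = p_hi $ k / (C_l G k * (v_lo $ k)\<^sup>2)"

definition delta_max :: "'n::finite microgrid \<Rightarrow> real^'n \<Rightarrow> real^'n \<Rightarrow> real" where
  "delta_max G p_hi v_lo = Max (range (delta_bar G p_hi v_lo))"

definition matAz ::
    "'n::finite microgrid \<Rightarrow> real^'n \<Rightarrow> real^'n \<Rightarrow> real^'n state_index^'n state_index" where
  "matAz G p_hi v_lo =
     matA G + (\<Sum>k\<in>UNIV. delta_bar G p_hi v_lo k *\<^sub>R diag_unit (VL k))"

end

theory Submission
  imports Defs
begin

text \<open>
  Write \<open>\<delta>\<^sub>k = p\<^sub>k / (C\<^sub>k v\<^sub>k\<^sup>2)\<close> at an equilibrium \<open>x\<^sub>e\<close> with load voltages \<open>v\<close> and load capacitances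
  \<open>C\<close>, let \<open>d\<^sub>k\<close> be the upper bound \<open>delta_bar\<close> of \<open>\<delta>\<^sub>k\<close>, let \<open>m\<close> be the maximum of the \<open>d\<^sub>k\<close>, and let
  \<open>D\<^sub>k\<close> be the diagonal unit at position \<open>VL k\<close>. The Jacobian of the field at \<open>x\<^sub>e\<close> is
  \<open>A + \<Sum>\<^sub>k \<delta>\<^sub>k D\<^sub>k\<close>, which differs from \<open>A\<^sub>z = A + \<Sum>\<^sub>k d\<^sub>k D\<^sub>k\<close> by a diagonal matrix with entries of
  modulus at most \<open>m\<close>. As \<open>P\<close> has operator norm at most \<open>t\<close>, this perturbation changes the quadratic
  form of \<open>P A\<^sub>z + A\<^sub>z\<^sup>T P\<close> by at most \<open>2 t m |y|\<^sup>2\<close>, and \<open>2 t m < \<gamma>\<close>, so that \<open>y\<^sup>T P y\<close> is a Lyapunov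
  function.

  No linearisation is needed: since \<open>1 / u - 1 / w = - (u - w) / (u w)\<close>, the identity
  \<open>f x - f x' = (A + \<Sum>\<^sub>k p\<^sub>k / (C\<^sub>k x\<^sub>k x'\<^sub>k) D\<^sub>k) (x - x')\<close> is exact (\<open>microgrid_field_diff\<close>, where
  \<open>x\<^sub>k\<close> is the entry of \<open>x\<close> at \<open>VL k\<close>). With \<open>x' = x\<^sub>e\<close>, and as long as each load voltage is at
  least half of its lower bound at equilibrium, the coefficient of \<open>D\<^sub>k\<close> lies in \<open>[0, 2 d\<^sub>k]\<close>, hence
  within \<open>m\<close> of the coefficient \<open>d\<^sub>k\<close> in \<open>A\<^sub>z\<close>. The dissipation estimate for \<open>y\<^sup>T P y\<close> thus holds
  on a whole ball about \<open>x\<^sub>e\<close>.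

  The passage from this estimate to exponential stability is
  \<open>locally_exponentially_stable_quadratic_Lyapunov\<close>. Solutions that start near \<open>x\<^sub>e\<close> cannot leave the
  ball because the Lyapunov function decreases (\<open>quadratic_Lyapunov_decay\<close>). Their existence for
  all forward time follows from global existence for Lipschitz fields
  (\<open>lipschitz_global_solution\<close>), applied to the field precomposed with the projection onto the
  ball; the solutions so obtained stay in the ball and hence solve the original equation.
\<close>

section \<open>Global solutions for Lipschitz vector fields\<close>

lemma norm_exp_weighted_integral_le:
  fixes h :: "real \<Rightarrow> 'a::banach"
  assumes "0 < l" "0 \<le> t" "continuous_on {0..t} h" "0 \<le> B"
    and "\<And>s. 0 \<le> s \<Longrightarrow> s \<le> t \<Longrightarrow> norm (h s) \<le> B * exp (l * s)"
  shows "norm (exp (- l * t) *\<^sub>R integral {0..t} h) \<le> B / l"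
proof -
  have I: "((\<lambda>s. B * exp (l * s)) has_integral (B / l * exp (l * t) - B / l * exp (l * 0))) {0..t}"
    using assms(1,2)
    by (intro fundamental_theorem_of_calculus)
       (auto intro!: derivative_eq_intros simp flip: has_real_derivative_iff_has_vector_derivative)
  have "norm (integral {0..t} h) \<le> integral {0..t} (\<lambda>s. B * exp (l * s))"
    using assms I by (intro integral_norm_bound_integral) (auto intro!: integrable_continuous_real continuous_intros)
  also have "\<dots> \<le> B / l * exp (l * t)"
    unfolding integral_unique[OF I] using assms by simp
  finally have "exp (- l * t) * norm (integral {0..t} h) \<le> exp (- l * t) * (B / l * exp (l * t))"
    by (intro mult_left_mono) auto
  also have "\<dots> = B / l"
    by (simp add: exp_minus field_simps)
  finally show ?thesis by simp
qed

text \<open>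
  The substitution \<open>x t = x0 + exp (l * t) *\<^sub>R u t\<close> with \<open>l > L\<close> turns the integral equation into a
  fixed point equation for a contraction with factor \<open>L / l\<close> on bounded continuous functions on
  the whole line, so that the solution is obtained on \<open>{0..}\<close> at once.
\<close>

lemma lipschitz_global_solution:
  fixes g :: "'a::banach \<Rightarrow> 'a"
  assumes lip: "L-lipschitz_on UNIV g"
  obtains x where "x 0 = x0"
    "\<And>t. 0 \<le> t \<Longrightarrow> (x has_vector_derivative g (x t)) (at t within {0..})"
proof -
  have L: "0 \<le> L" using lip by (rule lipschitz_on_nonneg)
  have gL: "norm (g a - g b) \<le> L * norm (a - b)" for a b
    using lipschitz_onD[OF lip, of a b] by (simp add: dist_norm)
  have gcont: "continuous_on S g" for S
    using lipschitz_on_continuous_on[OF lip] continuous_on_subset by blast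
  define l where "l = L + 1"
  have l: "0 < l" "0 \<le> L / l" "L / l < 1" using L by (auto simp: l_def)
  define H where "H u s = g (x0 + exp (l * s) *\<^sub>R apply_bcontfun u s)" for u :: "real \<Rightarrow>\<^sub>C 'a" and s
  \<comment> \<open>clamping at \<open>0\<close> extends the operator to functions on the whole line\<close>
  define F where "F u t = exp (- l * max 0 t) *\<^sub>R integral {0..max 0 t} (H u)" for u t
  have Hc: "continuous_on S (H u)" for S u
    unfolding H_def by (intro continuous_on_compose2[OF gcont[of UNIV]] continuous_intros) auto
  have Ic: "continuous_on {0..} (\<lambda>t. integral {0..t} (H u))" for u
  proof -
    have "continuous (at t within {0..}) (\<lambda>t. integral {0..t} (H u))" if "0 \<le> t" for t
    proof -
      have "continuous_on {0..t+1} (\<lambda>t. integral {0..t} (H u))"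
        by (intro indefinite_integral_continuous_1 integrable_continuous_real Hc)
      then have "continuous (at t within {0..t+1}) (\<lambda>t. integral {0..t} (H u))"
        using that by (auto simp: continuous_on_eq_continuous_within)
      moreover have "at t within {0..t+1} = at t within {0..}"
        using that by (intro at_within_nhd[where S = "{..<t+1}"]) auto
      ultimately show ?thesis by simp
    qed
    then show ?thesis by (auto simp: continuous_on_eq_continuous_within)
  qed
  have Fc: "continuous_on UNIV (F u)" for u
    unfolding F_def
    by (intro continuous_intros continuous_on_compose2[OF Ic]) auto
  have "norm (F u t) \<le> (norm (g x0) + L * norm u) / l" for u t
    unfolding F_def
  proof (rule norm_exp_weighted_integral_le)
    fix s :: real assume "0 \<le> s"
    have "norm (H u s) \<le> norm (g x0) + norm (H u s - g x0)"
      by (metis add.commute norm_triangle_sub)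
    also have "norm (H u s - g x0) \<le> L * (exp (l * s) * norm (apply_bcontfun u s))"
      unfolding H_def using gL[of "x0 + exp (l * s) *\<^sub>R apply_bcontfun u s" x0] by simp
    also have "\<dots> \<le> L * (exp (l * s) * norm u)"
      using L by (intro mult_left_mono norm_bounded) auto
    also have "norm (g x0) \<le> norm (g x0) * exp (l * s)"
      using \<open>0 \<le> s\<close> l by (simp add: mult_le_cancel_left1)
    finally show "norm (H u s) \<le> (norm (g x0) + L * norm u) * exp (l * s)"
      by (simp add: algebra_simps)
  qed (use l L Hc in auto)
  then have Fb: "F u \<in> bcontfun" for u
    using Fc by (intro bcontfun_normI)
  have contr: "dist (Bcontfun (F u)) (Bcontfun (F v)) \<le> L / l * dist u v" for u v
  proof (rule dist_bound)
    fix t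
    have int: "H u integrable_on {0..t}" for u t
      by (intro integrable_continuous_real Hc)
    have "norm (exp (- l * max 0 t) *\<^sub>R integral {0..max 0 t} (\<lambda>s. H u s - H v s))
        \<le> (L * dist u v) / l"
    proof (rule norm_exp_weighted_integral_le)
      fix s :: real
      have "norm (H u s - H v s)
          \<le> L * norm ((x0 + exp (l * s) *\<^sub>R apply_bcontfun u s) - (x0 + exp (l * s) *\<^sub>R apply_bcontfun v s))"
        unfolding H_def by (rule gL)
      also have "\<dots> = L * (exp (l * s) * dist (apply_bcontfun u s) (apply_bcontfun v s))"
        by (simp add: dist_norm flip: scaleR_diff_right)
      also have "\<dots> \<le> L * (exp (l * s) * dist u v)"
        using L by (intro mult_left_mono dist_bounded) auto
      finally show "norm (H u s - H v s) \<le> L * dist u v * exp (l * s)"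
        by (simp add: mult_ac)
    qed (use l L Hc in \<open>auto intro!: continuous_intros\<close>)
    then show "dist (apply_bcontfun (Bcontfun (F u)) t) (apply_bcontfun (Bcontfun (F v)) t)
        \<le> L / l * dist u v"
      by (simp add: Bcontfun_inverse Fb F_def dist_norm integral_diff[OF int int] scaleR_diff_right)
  qed
  obtain u where u: "Bcontfun (F u) = u"
    using banach_fix_type[OF l(2,3), of "\<lambda>u. Bcontfun (F u)"] contr by blast
  define x where "x t = x0 + integral {0..t} (H u)" for t
  have Hx: "H u t = g (x t)" if "0 \<le> t" for t
  proof -
    have "apply_bcontfun u t = F u t" using u Fb by (metis Bcontfun_inverse)
    then have "exp (l * t) *\<^sub>R apply_bcontfun u t = integral {0..t} (H u)"
      using that by (simp add: F_def flip: exp_add)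
    then show ?thesis by (simp add: H_def x_def)
  qed
  show thesis
  proof (rule that[of x])
    show "x 0 = x0" by (simp add: x_def)
    fix t :: real assume t: "0 \<le> t"
    have "((\<lambda>t. integral {0..t} (H u)) has_vector_derivative H u t) (at t within {0..t+1})"
      using t by (intro integral_has_vector_derivative Hc) auto
    then have "(x has_vector_derivative H u t) (at t within {0..t+1})"
      unfolding x_def by (auto intro!: derivative_eq_intros)
    moreover have "at t within {0..t+1} = at t within {0..}"
      using t by (intro at_within_nhd[where S = "{..<t+1}"]) auto
    ultimately show "(x has_vector_derivative g (x t)) (at t within {0..})"
      using Hx[OF t] by simp
  qed
qed

section \<open>Positive definite forms\<close>

lemma symmetric_inner_matrix_vector:
  fixes P :: "real^'m^'m"
  assumes "transpose P = P"
  shows "x \<bullet> (P *v y) = y \<bullet> (P *v x)"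
proof -
  have "x \<bullet> (P *v y) = (transpose P *v x) \<bullet> y"
    by (simp add: transpose_matrix_vector dot_lmul_matrix)
  then show ?thesis by (simp add: assms inner_commute)
qed

lemma pos_def_lower_bound:
  fixes P :: "real^'m^'m"
  assumes "pos_def P"
  obtains a where "0 < a" "\<And>y. a * (norm y)\<^sup>2 \<le> y \<bullet> (P *v y)"
proof -
  have "\<exists>x\<in>sphere (0::real^'m) 1. \<forall>y\<in>sphere 0 1. x \<bullet> (P *v x) \<le> y \<bullet> (P *v y)"
    by (intro continuous_attains_inf continuous_intros compact_sphere matrix_vector_mult_linear_continuous_on) auto
  then obtain x :: "real^'m" where x: "norm x = 1" "\<And>y. norm y = 1 \<Longrightarrow> x \<bullet> (P *v x) \<le> y \<bullet> (P *v y)"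
    by auto
  show thesis
  proof (rule that)
    show "0 < x \<bullet> (P *v x)" proof -
      have "x \<noteq> 0" using x(1) by auto
      then show ?thesis using assms by (simp add: pos_def_def)
    qed
    show "x \<bullet> (P *v x) * (norm y)\<^sup>2 \<le> y \<bullet> (P *v y)" for y
    proof (cases "y = 0")
      case False
      let ?z = "(1 / norm y) *\<^sub>R y"
      have "x \<bullet> (P *v x) \<le> ?z \<bullet> (P *v ?z)" using False by (intro x) simp
      also have "\<dots> = y \<bullet> (P *v y) / (norm y)\<^sup>2"
        by (simp add: matrix_vector_mult_scaleR power2_eq_square)
      finally show ?thesis using False by (simp add: field_simps)
    qed simp
  qed
qed

lemma loewner_le_scaled_identityD:
  fixes M :: "real^'m^'m"
  assumes "M \<preceq> c *\<^sub>R mat 1"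
  shows "y \<bullet> (M *v y) \<le> c * (norm y)\<^sup>2"
  using assms unfolding loewner_le_def pos_semidef_def
  by (auto simp: matrix_vector_mult_diff_rdistrib inner_diff_right power2_norm_eq_inner
      scaleR_matrix_vector_assoc[symmetric] dest: spec[of _ y])

text \<open>
  For a positive definite form the bound on the form bounds the operator norm with the same constant,
  by polarisation applied to \<open>y\<close> and the multiple of \<open>P *v y\<close> of the same length.
\<close>

lemma pos_def_norm_le:
  fixes P :: "real^'m^'m"
  assumes P: "pos_def P" and le: "\<And>y. y \<bullet> (P *v y) \<le> t * (norm y)\<^sup>2" and "0 \<le> t"
  shows "norm (P *v y) \<le> t * norm y"
proof (cases "P *v y = 0 \<or> y = 0")
  case True then show ?thesis using \<open>0 \<le> t\<close> by auto
next
  case False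
  define z where "z = (norm y / norm (P *v y)) *\<^sub>R (P *v y)"
  have nz: "norm z = norm y" using False by (simp add: z_def)
  have "4 * (z \<bullet> (P *v y)) = (y + z) \<bullet> (P *v (y + z)) - (y - z) \<bullet> (P *v (y - z))"
    using symmetric_inner_matrix_vector[of P y z] P
    by (simp add: pos_def_def matrix_vector_right_distrib matrix_vector_mult_diff_distrib algebra_simps)
  also have "\<dots> \<le> (y + z) \<bullet> (P *v (y + z))"
    using P unfolding pos_def_def by (cases "y - z = 0") (auto simp: less_imp_le)
  also have "\<dots> \<le> t * (norm (y + z))\<^sup>2" by (rule le)
  also have "\<dots> \<le> t * (2 * norm y)\<^sup>2"
    using norm_triangle_ineq[of y z] nz \<open>0 \<le> t\<close> by (intro mult_left_mono power_mono) auto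
  finally have "z \<bullet> (P *v y) \<le> t * (norm y)\<^sup>2" by simp
  moreover have "z \<bullet> (P *v y) = norm y * norm (P *v y)"
    using False by (simp add: z_def dot_square_norm power2_eq_square)
  ultimately show ?thesis using False by (simp add: power2_eq_square mult_ac)
qed

section \<open>Exponential stability from a quadratic Lyapunov function\<close>

text \<open>
  By the differential inequality \<open>V' \<le> - (b / t) * V\<close>, the function \<open>exp (b / t * s) * V s\<close> is
  nonincreasing.
\<close>

lemma quadratic_Lyapunov_decay_inside:
  fixes P :: "real^'m^'m" and x :: "real \<Rightarrow> real^'m"
  assumes P: "transpose P = P" and t: "\<And>y. y \<bullet> (P *v y) \<le> t * (norm y)\<^sup>2" "0 < t"
    and "0 \<le> b" and T: "0 \<le> T"
    and sol: "\<And>s. s \<in> {0..T} \<Longrightarrow> (x has_vector_derivative f (x s)) (at s within {0..T})"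
    and est: "\<And>s. 0 < s \<Longrightarrow> s < T \<Longrightarrow>
      2 * ((x s - xe) \<bullet> (P *v f (x s))) \<le> - b * (norm (x s - xe))\<^sup>2"
  shows "(x T - xe) \<bullet> (P *v (x T - xe)) \<le> exp (- (b / t) * T) * ((x 0 - xe) \<bullet> (P *v (x 0 - xe)))"
proof -
  define V where "V s = (x s - xe) \<bullet> (P *v (x s - xe))" for s
  have bl: "bounded_linear ((*v) P)" by simp
  have V': "(V has_real_derivative 2 * ((x s - xe) \<bullet> (P *v f (x s)))) (at s within S)"
    if "(x has_vector_derivative f (x s)) (at s within S)" for s S
  proof -
    have d: "((\<lambda>s. x s - xe) has_vector_derivative f (x s)) (at s within S)"
      using that by (auto intro!: derivative_eq_intros)
    have "((\<lambda>s. P *v (x s - xe)) has_vector_derivative P *v f (x s)) (at s within S)"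
      using bounded_linear.has_vector_derivative[OF bl d] .
    from bounded_bilinear.has_vector_derivative[OF bounded_bilinear_inner d this]
    show ?thesis
      unfolding V_def has_real_derivative_iff_has_vector_derivative
      by (simp add: symmetric_inner_matrix_vector[OF P, of "f (x s)"])
  qed
  define W where "W s = exp (b / t * s) * V s" for s
  have "W T \<le> W 0"
  proof (rule DERIV_nonpos_imp_decreasing_open[OF T])
    fix s assume s: "0 < s" "s < T"
    have "(x has_vector_derivative f (x s)) (at s)"
      using sol[of s] s at_within_interior[of s "{0..T}"] by simp
    from V'[OF this]
    have "(W has_real_derivative exp (b / t * s) * (b / t * V s + 2 * ((x s - xe) \<bullet> (P *v f (x s))))) (at s)"
      unfolding W_def using t(2) by (auto intro!: derivative_eq_intros simp: algebra_simps)
    moreover have "b / t * V s \<le> b * (norm (x s - xe))\<^sup>2"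
      using mult_left_mono[OF t(1)[of "x s - xe"], of "b / t"] t(2) \<open>0 \<le> b\<close> by (simp add: V_def)
    then have "b / t * V s + 2 * ((x s - xe) \<bullet> (P *v f (x s))) \<le> 0"
      using est[OF s] by simp
    then have "exp (b / t * s) * (b / t * V s + 2 * ((x s - xe) \<bullet> (P *v f (x s)))) \<le> 0"
      by (simp add: mult_le_0_iff)
    ultimately show "\<exists>y. DERIV W s :> y \<and> y \<le> 0" by blast
  next
    have "continuous_on {0..T} V"
      using V'[OF sol] by (meson DERIV_continuous continuous_on_eq_continuous_within)
    then show "continuous_on {0..T} W"
      unfolding W_def by (intro continuous_intros)
  qed
  then have "exp (- (b / t) * T) * W T \<le> exp (- (b / t) * T) * V 0"
    by (intro mult_left_mono) (auto simp: W_def)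
  moreover have "exp (- (b / t) * T) * W T = V T"
    by (simp add: W_def mult.assoc[symmetric] flip: exp_add)
  ultimately show ?thesis unfolding V_def by argo
qed

text \<open>
  The estimate on the derivative is only available in a ball, so the first exit time has to be
  excluded: there, the form would be at least \<open>a * r\<^sup>2\<close>, which exceeds its initial value.
\<close>

lemma quadratic_Lyapunov_decay:
  fixes P :: "real^'m^'m" and x :: "real \<Rightarrow> real^'m"
  assumes P: "transpose P = P"
    and a: "\<And>y. a * (norm y)\<^sup>2 \<le> y \<bullet> (P *v y)" "0 < a"
    and t: "\<And>y. y \<bullet> (P *v y) \<le> t * (norm y)\<^sup>2" "0 < t"
    and b: "0 \<le> b" and r: "0 < r"
    and est: "\<And>z. z \<in> cball xe r \<Longrightarrow> 2 * ((z - xe) \<bullet> (P *v f z)) \<le> - b * (norm (z - xe))\<^sup>2"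
    and T: "0 \<le> T"
    and sol: "\<And>s. s \<in> {0..T} \<Longrightarrow> (x has_vector_derivative f (x s)) (at s within {0..T})"
    and init: "norm (x 0 - xe) < sqrt (a / t) * r"
  shows "norm (x T - xe) < r"
    and "norm (x T - xe) \<le> sqrt (t / a) * exp (- (b / (2 * t)) * T) * norm (x 0 - xe)"
proof -
  define V where "V s = (x s - xe) \<bullet> (P *v (x s - xe))" for s
  have decay: "V s \<le> exp (- (b / t) * s) * V 0"
    if s: "0 \<le> s" "s \<le> T" and ins: "\<And>u. 0 < u \<Longrightarrow> u < s \<Longrightarrow> norm (x u - xe) < r" for s
    unfolding V_def
  proof (rule quadratic_Lyapunov_decay_inside[where f = f])
    show "(x has_vector_derivative f (x u)) (at u within {0..s})" if "u \<in> {0..s}" for u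
      using sol[of u] that s by (auto intro: has_vector_derivative_within_subset)
    show "2 * ((x u - xe) \<bullet> (P *v f (x u))) \<le> - b * (norm (x u - xe))\<^sup>2" if "0 < u" "u < s" for u
      using ins[OF that] by (intro est) (simp add: dist_norm norm_minus_commute)
  qed (use P t b s in auto)
  have "V 0 \<le> t * (norm (x 0 - xe))\<^sup>2" unfolding V_def by (rule t)
  also have "\<dots> < t * (sqrt (a / t) * r)\<^sup>2"
    using init t(2) by (intro mult_strict_left_mono power_strict_mono) auto
  also have "\<dots> = a * r\<^sup>2" using a(2) t(2) by (simp add: power_mult_distrib)
  finally have V0: "V 0 < a * r\<^sup>2" .
  have V0_nonneg: "0 \<le> V 0"
    using a(1)[of "x 0 - xe"] a(2) unfolding V_def by (meson order_trans mult_nonneg_nonneg less_imp_le zero_le_power2)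
  have inside: "norm (x s - xe) < r" if "0 \<le> s" "s \<le> T" for s
  proof (rule ccontr)
    assume "\<not> norm (x s - xe) < r"
    define E where "E = {s \<in> {0..T}. r \<le> norm (x s - xe)}"
    have "continuous_on {0..T} x"
      using sol by (meson has_vector_derivative_continuous continuous_on_eq_continuous_within)
    then have "closed E"
      unfolding E_def by (intro continuous_on_closed_Collect_le continuous_intros) auto
    moreover have ne: "E \<noteq> {}" "bdd_below E"
      using that \<open>\<not> _\<close> by (auto simp: E_def intro!: bdd_belowI[of _ 0])
    ultimately have e: "Inf E \<in> E" by (intro closed_contains_Inf)
    have "norm (x u - xe) < r" if "0 < u" "u < Inf E" for u
    proof -
      have "u \<notin> E" using that(2) ne(2) by (meson cInf_lower not_le)
      then show ?thesis using that e by (auto simp: E_def)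
    qed
    then have "V (Inf E) \<le> exp (- (b / t) * Inf E) * V 0"
      using e by (intro decay) (auto simp: E_def)
    also have "\<dots> \<le> 1 * V 0"
      using e b t(2) V0_nonneg by (intro mult_right_mono) (auto simp: E_def)
    also have "\<dots> < a * r\<^sup>2" using V0 by simp
    also have "\<dots> \<le> a * (norm (x (Inf E) - xe))\<^sup>2"
      using e a(2) r by (intro mult_left_mono power_mono) (auto simp: E_def)
    also have "\<dots> \<le> V (Inf E)" unfolding V_def by (rule a)
    finally show False by simp
  qed
  show "norm (x T - xe) < r" using inside T by auto
  have "a * (norm (x T - xe))\<^sup>2 \<le> V T" unfolding V_def by (rule a)
  also have "\<dots> \<le> exp (- (b / t) * T) * V 0" using T inside by (intro decay) auto
  also have "\<dots> \<le> exp (- (b / t) * T) * (t * (norm (x 0 - xe))\<^sup>2)"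
    unfolding V_def by (intro mult_left_mono t) auto
  finally have "(norm (x T - xe))\<^sup>2 \<le> t / a * exp (- (b / t) * T) * (norm (x 0 - xe))\<^sup>2"
    using a(2) by (simp add: field_simps)
  also have "exp (- (b / t) * T) = (exp (- (b / (2 * t)) * T))\<^sup>2"
    using t(2) by (simp add: power2_eq_square field_simps flip: exp_add)
  also have "t / a = (sqrt (t / a))\<^sup>2" using a(2) t(2) by simp
  finally have "(norm (x T - xe))\<^sup>2 \<le> (sqrt (t / a) * exp (- (b / (2 * t)) * T) * norm (x 0 - xe))\<^sup>2"
    by (simp add: power_mult_distrib)
  then show "norm (x T - xe) \<le> sqrt (t / a) * exp (- (b / (2 * t)) * T) * norm (x 0 - xe)"
    by (rule power2_le_imp_le) (use a(2) t(2) in simp)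
qed

lemma locally_exponentially_stable_quadratic_Lyapunov:
  fixes P :: "real^'m^'m" and f :: "real^'m \<Rightarrow> real^'m"
  assumes P: "pos_def P" and t: "\<And>y. y \<bullet> (P *v y) \<le> t * (norm y)\<^sup>2" "0 < t"
    and xe: "f xe = 0" and r: "0 < r" "cball xe r \<subseteq> D" and lip: "L-lipschitz_on (cball xe r) f"
    and b: "0 < b"
    and est: "\<And>z. z \<in> cball xe r \<Longrightarrow> 2 * ((z - xe) \<bullet> (P *v f z)) \<le> - b * (norm (z - xe))\<^sup>2"
  shows "locally_exponentially_stable f D xe"
proof -
  obtain a where a: "0 < a" "\<And>y. a * (norm y)\<^sup>2 \<le> y \<bullet> (P *v y)"
    using pos_def_lower_bound[OF P] by blast
  have sym: "transpose P = P" using P by (simp add: pos_def_def)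
  define proj where "proj = closest_point (cball xe r)"
  \<comment> \<open>a globally Lipschitz field that agrees with \<open>f\<close> on the ball\<close>
  define g where "g = f \<circ> proj"
  have proj_in: "proj z \<in> cball xe r" for z
    unfolding proj_def using r(1) by (intro closest_point_in_set) auto
  have g_eq: "g z = f z" if "z \<in> cball xe r" for z
    using that by (simp add: g_def proj_def closest_point_self)
  have "1-lipschitz_on UNIV proj"
    using r(1) closest_point_lipschitz[of "cball xe r"] by (intro lipschitz_onI) (auto simp: proj_def)
  moreover have "L-lipschitz_on (proj ` UNIV) f"
    using lip proj_in by (elim lipschitz_on_subset) auto
  ultimately have glip: "(L * 1)-lipschitz_on UNIV g"
    unfolding g_def by (rule lipschitz_on_compose)
  have gest: "2 * ((z - xe) \<bullet> (P *v g z)) \<le> - b * (norm (z - xe))\<^sup>2" if "z \<in> cball xe r" for z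
    using est[OF that] g_eq[OF that] by simp
  define c where "c = sqrt (a / t) * r"
  have "\<exists>x. x 0 = x0 \<and> solution_on f D x {0..}" if x0: "norm (x0 - xe) < c" for x0
  proof -
    obtain x where x: "x 0 = x0"
      "\<And>s. 0 \<le> s \<Longrightarrow> (x has_vector_derivative g (x s)) (at s within {0..})"
      using lipschitz_global_solution[OF glip] by blast
    have "x s \<in> cball xe r" if "0 \<le> s" for s
    proof -
      have "norm (x s - xe) < r"
      proof (rule quadratic_Lyapunov_decay(1)[OF sym a(2,1) t less_imp_le[OF b] r(1) gest that])
        show "(x has_vector_derivative g (x u)) (at u within {0..s})" if "u \<in> {0..s}" for u
          using x(2)[of u] that by (auto intro: has_vector_derivative_within_subset)
        show "norm (x 0 - xe) < sqrt (a / t) * r" using x0 x(1) by (simp add: c_def)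
      qed
      then show ?thesis by (simp add: dist_norm norm_minus_commute)
    qed
    then have "solution_on f D x {0..}"
      unfolding solution_on_def using x(2) g_eq r(2) by fastforce
    with x(1) show ?thesis by blast
  qed
  moreover have "norm (x T - xe) \<le> sqrt (t / a) * exp (- (b / (2 * t)) * T) * norm (x 0 - xe)"
    if "norm (x 0 - xe) < c" "0 \<le> T" "solution_on f D x {0..T}" for x T
    using that by (intro quadratic_Lyapunov_decay(2)[OF sym a(2,1) t less_imp_le[OF b] r(1) est])
      (auto simp: c_def solution_on_def)
  moreover have "0 < c" "0 < sqrt (t / a)" "0 < b / (2 * t)"
    using a(1) t(2) r(1) b by (auto simp: c_def)
  moreover have "xe \<in> D" using r by auto
  ultimately show ?thesis
    unfolding locally_exponentially_stable_def using xe by metis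
qed

section \<open>The microgrid field\<close>

lemma diag_unit_VL_mult:
  "((\<Sum>k\<in>UNIV. e k *\<^sub>R diag_unit (VL k)) *v y) =
    (\<chi> i. case i of VL k \<Rightarrow> e k * y $ VL k | _ \<Rightarrow> 0)"
  for y :: "real^('n::finite) state_index"
proof -
  have d: "(diag_unit m *v y) $ i = (if i = m then y $ m else 0)" for m i :: "'n state_index"
    by (simp add: diag_unit_def matrix_vector_mult_def if_distrib[of "\<lambda>c. c * _"] cong: if_cong)
  have "Modules.additive (\<lambda>M. M *v y)"
    by (simp add: Modules.additive_def matrix_vector_mult_add_rdistrib)
  from Modules.additive.sum[OF this, of "\<lambda>k. e k *\<^sub>R diag_unit (VL k)" UNIV]
  have "((\<Sum>k\<in>UNIV. e k *\<^sub>R diag_unit (VL k)) *v y) = (\<Sum>k\<in>UNIV. e k *\<^sub>R (diag_unit (VL k) *v y))"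
    by (simp add: scaleR_matrix_vector_assoc)
  then show ?thesis
    by (auto simp: vec_eq_iff d if_distrib[where f = "(*) c" for c] cong: if_cong split: state_index.split)
qed

lemma norm_diag_unit_VL_mult_le:
  fixes y :: "real^('n::finite) state_index"
  assumes "\<And>k. \<bar>e k\<bar> \<le> m" "0 \<le> m"
  shows "norm ((\<Sum>k\<in>UNIV. e k *\<^sub>R diag_unit (VL k)) *v y) \<le> m * norm y"
proof -
  have "norm ((\<Sum>k\<in>UNIV. e k *\<^sub>R diag_unit (VL k)) *v y) \<le> norm (m *\<^sub>R y)"
    using assms
    by (intro norm_le_componentwise_cart)
       (auto simp: diag_unit_VL_mult abs_mult mult_right_mono split: state_index.split)
  then show ?thesis using assms(2) by simp
qed

lemma microgrid_field_diff:
  fixes x x' :: "real^('n::finite) state_index"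
  assumes "x \<in> microgrid_domain" "x' \<in> microgrid_domain"
  shows "microgrid_field G p x - microgrid_field G p x' =
    (matA G + (\<Sum>k\<in>UNIV. (p $ k / (C_l G k * (x $ VL k * x' $ VL k))) *\<^sub>R diag_unit (VL k))) *v (x - x')"
proof -
  have "matC G *v (load_currents p x - load_currents p x') =
    (\<Sum>k\<in>UNIV. (p $ k / (C_l G k * (x $ VL k * x' $ VL k))) *\<^sub>R diag_unit (VL k)) *v (x - x')"
  proof -
    have "(1 / C_l G k) * (- (p $ k) / x $ VL k - - (p $ k) / x' $ VL k) =
        p $ k / (C_l G k * (x $ VL k * x' $ VL k)) * (x - x') $ VL k" for k
      using assms by (simp add: microgrid_domain_def field_simps)
    then show ?thesis
      unfolding diag_unit_VL_mult
      by (auto simp: vec_eq_iff matC_def matrix_vector_mult_def load_currents_def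
          if_distrib[of "\<lambda>c. c * _"] cong: if_cong split: state_index.split)
  qed
  then show ?thesis
    by (simp add: microgrid_field_def matrix_vector_mult_add_rdistrib matrix_vector_mult_diff_distrib algebra_simps)
qed

theorem lemma2:
  fixes G :: "'n::finite microgrid"
    and p_lo p_hi v_lo v_hi :: "real^'n"
  assumes "valid_microgrid G"
    and "\<forall>k. 0 \<le> p_lo $ k \<and> p_lo $ k \<le> p_hi $ k"
    and "\<forall>k. 0 < v_lo $ k \<and> v_lo $ k \<le> v_hi $ k"
    and "\<exists>(P :: real^'n state_index^'n state_index) (t :: real) (\<gamma> :: real).
           P ** matAz G p_hi v_lo + transpose (matAz G p_hi v_lo) ** P \<preceq> (- \<gamma>) *\<^sub>R mat 1 \<and>
           P \<preceq> t *\<^sub>R mat 1 \<and>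
           2 * t * delta_max G p_hi v_lo < \<gamma> \<and>
           P = transpose P \<and> pos_def P \<and> \<gamma> > 0 \<and> t > 0"
  shows "locally_robustly_stable G (cbox p_lo p_hi) (cbox v_lo v_hi)"
  unfolding locally_robustly_stable_def
proof (intro ballI impI)
  fix xe p
  assume xe_eq: "xe \<in> equilibria G (cbox p_lo p_hi) (cbox v_lo v_hi)"
    and p_box: "p \<in> cbox p_lo p_hi" and f0: "microgrid_field G p xe = 0"
  obtain P :: "real^'n state_index^'n state_index" and t \<gamma> :: real where
    lyap: "P ** matAz G p_hi v_lo + transpose (matAz G p_hi v_lo) ** P \<preceq> (- \<gamma>) *\<^sub>R mat 1"
    and Pt: "P \<preceq> t *\<^sub>R mat 1" and gap: "2 * t * delta_max G p_hi v_lo < \<gamma>"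
    and P: "pos_def P" and t: "0 < t"
    using assms(4) by blast
  let ?Az = "matAz G p_hi v_lo" and ?f = "microgrid_field G p"
    and ?d = "delta_bar G p_hi v_lo" and ?m = "delta_max G p_hi v_lo"
  have sym: "transpose P = P" using P by (simp add: pos_def_def)
  note form_le = loewner_le_scaled_identityD[OF Pt]
  have v: "v_lo $ k \<le> xe $ VL k" "0 < v_lo $ k" for k
    using xe_eq assms(3) by (auto simp: equilibria_def load_voltages_def mem_box_cart)
  have p: "0 \<le> p $ k" "p $ k \<le> p_hi $ k" for k
    using p_box assms(2) by (auto simp: mem_box_cart intro: order_trans)
  have C: "0 < C_l G k" for k using assms(1) by (simp add: valid_microgrid_def)
  have d: "0 \<le> ?d k" "?d k \<le> ?m" for k
    using p[of k] C[of k] by (auto simp: delta_bar_def delta_max_def)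
  have m: "0 \<le> ?m" using d order_trans by blast

  \<comment> \<open>in the ball of this radius, load voltages are at least half of their lower bounds\<close>
  define r where "r = Min (range (\<lambda>k. v_lo $ k)) / 2"
  have r: "0 < r" using v(2) by (simp add: r_def)
  have ball: "v_lo $ k / 2 \<le> z $ VL k" if "z \<in> cball xe r" for z k
  proof -
    have "\<bar>(xe - z) $ VL k\<bar> \<le> norm (xe - z)" by (rule component_le_norm_cart)
    also have "\<dots> \<le> r" using that by (simp add: dist_norm)
    also have "\<dots> \<le> v_lo $ k / 2" by (simp add: r_def)
    finally have "\<bar>(xe - z) $ VL k\<bar> \<le> v_lo $ k / 2" .
    then show ?thesis using v(1)[of k] unfolding vector_minus_component by linarith
  qed
  have dom: "cball xe r \<subseteq> microgrid_domain"
    using ball v(2) unfolding microgrid_domain_def by (smt (verit) half_gt_zero mem_Collect_eq subsetI)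
  have coeff: "0 \<le> p $ k / (C_l G k * (u * w))" "p $ k / (C_l G k * (u * w)) \<le> c * ?d k"
    if "0 < u" "0 < w" "0 < c" "(v_lo $ k)\<^sup>2 \<le> c * (u * w)" for k u w c
  proof -
    show "0 \<le> p $ k / (C_l G k * (u * w))" using that p[of k] C[of k] by simp
    have "p $ k / (C_l G k * (u * w)) \<le> p_hi $ k / (C_l G k * ((v_lo $ k)\<^sup>2 / c))"
      using that p[of k] C[of k] v(2)[of k]
      by (intro frac_le mult_left_mono) (auto simp: field_simps)
    then show "p $ k / (C_l G k * (u * w)) \<le> c * ?d k" by (simp add: delta_bar_def mult.commute)
  qed

  have lip: "(onorm ((*v) (matA G)) + 4 * ?m)-lipschitz_on (cball xe r) ?f"
  proof (rule lipschitz_onI)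
    show "0 \<le> onorm ((*v) (matA G)) + 4 * ?m" using m onorm_pos_le[of "(*v) (matA G)"] by simp
    fix z z' assume z: "z \<in> cball xe r" "z' \<in> cball xe r"
    let ?e = "\<lambda>k. p $ k / (C_l G k * (z $ VL k * z' $ VL k))"
    have "\<bar>?e k\<bar> \<le> 4 * ?m" for k
    proof -
      have "0 < z $ VL k" "0 < z' $ VL k" using ball[OF z(1), of k] ball[OF z(2), of k] v(2)[of k] by auto
      moreover have "v_lo $ k / 2 * (v_lo $ k / 2) \<le> z $ VL k * z' $ VL k"
        using ball[OF z(1), of k] ball[OF z(2), of k] v(2)[of k] by (intro mult_mono) auto
      ultimately show ?thesis
        using coeff[of "z $ VL k" "z' $ VL k" 4 k] d(2)[of k] by (simp add: power2_eq_square)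
    qed
    then have "norm ((\<Sum>k\<in>UNIV. ?e k *\<^sub>R diag_unit (VL k)) *v (z - z')) \<le> 4 * ?m * norm (z - z')"
      using m by (intro norm_diag_unit_VL_mult_le) auto
    moreover have "norm (matA G *v (z - z')) \<le> onorm ((*v) (matA G)) * norm (z - z')"
      by (intro onorm) simp
    moreover have "?f z - ?f z' = matA G *v (z - z') + (\<Sum>k\<in>UNIV. ?e k *\<^sub>R diag_unit (VL k)) *v (z - z')"
      using microgrid_field_diff[OF subsetD[OF dom z(1)] subsetD[OF dom z(2)], of G p]
      by (simp only: matrix_vector_mult_add_rdistrib)
    ultimately show "dist (?f z) (?f z') \<le> (onorm ((*v) (matA G)) + 4 * ?m) * dist z z'"
      unfolding dist_norm distrib_right by (metis (no_types, lifting) add_mono norm_triangle_le)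
  qed

  have est: "2 * ((z - xe) \<bullet> (P *v ?f z)) \<le> - (\<gamma> - 2 * t * ?m) * (norm (z - xe))\<^sup>2"
    if z: "z \<in> cball xe r" for z
  proof -
    define y where "y = z - xe"
    \<comment> \<open>the deviation from the coefficients of \<open>?Az\<close>\<close>
    define e where "e k = p $ k / (C_l G k * (z $ VL k * xe $ VL k)) - ?d k" for k
    let ?E = "\<Sum>k\<in>UNIV. e k *\<^sub>R diag_unit (VL k)"
    have e: "\<bar>e k\<bar> \<le> ?m" for k
    proof -
      have "0 < z $ VL k" "0 < xe $ VL k" using ball[OF z, of k] v[of k] by auto
      moreover have "v_lo $ k / 2 * v_lo $ k \<le> z $ VL k * xe $ VL k"
        using ball[OF z, of k] v[of k] by (intro mult_mono) auto
      ultimately show ?thesis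
        using coeff[of "z $ VL k" "xe $ VL k" 2 k] d[of k] by (simp add: e_def power2_eq_square)
    qed
    have "?f z = (?Az + ?E) *v y"
      using microgrid_field_diff[OF subsetD[OF dom z] subsetD[OF dom, of xe], of G p] r f0
      by (simp add: y_def matAz_def e_def scaleR_diff_left sum_subtractf)
    then have "y \<bullet> (P *v ?f z) = y \<bullet> (P *v (?Az *v y)) + y \<bullet> (P *v (?E *v y))"
      by (simp add: matrix_vector_mult_add_rdistrib matrix_vector_right_distrib inner_add_right)
    moreover have "2 * (y \<bullet> (P *v (?Az *v y))) \<le> - \<gamma> * (norm y)\<^sup>2"
    proof -
      have "y \<bullet> ((transpose ?Az ** P) *v y) = (?Az *v y) \<bullet> (P *v y)"
        unfolding matrix_vector_mul_assoc[symmetric] transpose_matrix_vector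
        by (metis dot_lmul_matrix inner_commute)
      also have "\<dots> = y \<bullet> (P *v (?Az *v y))"
        by (rule symmetric_inner_matrix_vector[OF sym])
      finally have "y \<bullet> ((transpose ?Az ** P) *v y) = y \<bullet> (P *v (?Az *v y))" .
      then show ?thesis
        using loewner_le_scaled_identityD[OF lyap, of y]
        by (simp add: matrix_vector_mult_add_rdistrib inner_add_right matrix_vector_mul_assoc)
    qed
    moreover have "y \<bullet> (P *v (?E *v y)) \<le> t * ?m * (norm y)\<^sup>2"
    proof -
      have "y \<bullet> (P *v (?E *v y)) = (?E *v y) \<bullet> (P *v y)"
        by (rule symmetric_inner_matrix_vector[OF sym])
      also have "\<dots> \<le> norm (?E *v y) * norm (P *v y)" by (rule norm_cauchy_schwarz)
      also have "\<dots> \<le> (?m * norm y) * (t * norm y)"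
        using m t
        by (intro mult_mono norm_diag_unit_VL_mult_le[OF e m] pos_def_norm_le[OF P form_le]) auto
      finally show ?thesis by (simp add: power2_eq_square mult_ac)
    qed
    ultimately show ?thesis unfolding y_def[symmetric] by (simp add: algebra_simps)
  qed

  show "locally_exponentially_stable ?f microgrid_domain xe"
    using locally_exponentially_stable_quadratic_Lyapunov[OF P form_le t f0 r dom lip _ est] gap by simp
qed

end
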